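(* Let $w\in W$ with a fixed reduced decomposition $w=s_{i_1}\cdots s_{i_t}$ and let $\Delta\subseteq\{1,\dots,t\}$ be any subset. Let $\Psi:\ker(w+w^\Delta)\to\ker(M(w^\Delta))$ be defined by $$\Psi(\gamma)=\sum_{h=1}^m\langle(\beta_{t_h}^\Delta)^\vee|w^\Delta(\gamma)\rangle\,\boldsymbol{e}_h.$$ Then $\Psi$ is an isomorphism (of $\mathbb{Q}$-vector spaces).
   Context: $\mathfrak g$ is a simple complex Lie algebra of rank $n$ with simple roots $\alpha_1,\dots,\alpha_n$, a basis of a Euclidean space with $W$-invariant inner product $\langle\cdot|\cdot\rangle$ normalised so that short roots have length $\sqrt2$; $W$ is the Weyl group, generated by the simple reflections $s_i=s_{\alpha_i}$. For a root $\alpha$, $\alpha^\vee=2\alpha/\langle\alpha|\alpha\rangle$; the fundamental weights $\varpi_j$ are defined by $\langle\varpi_j|\alpha_i^\vee\rangle=\delta_{ij}$; $V=\bigoplus_{i=1}^n\mathbb{Q}\varpi_i$, on which $W$ acts. For $w=s_{i_1}\cdots s_{i_t}$ reduced ($t=l(w)$), put $\beta_k=s_{i_1}\cdots s_{i_{k-1}}(\alpha_{i_k})$ for $1\le k\le t$. For $\Delta\subseteq\{1,\dots,t\}$ write $\{t_1<\cdots<t_m\}=\{1,\dots,t\}\setminus\Delta$; put $s_{i_k}^\Delta=s_{i_k}$ if $k\in\Delta$ and $s_{i_k}^\Delta=\mathrm{id}$ otherwise, $w^\Delta=s_{i_1}^\Delta\cdots s_{i_t}^\Delta\in W$, and $\beta_k^\Delta=s_{i_1}^\Delta\cdots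 s_{i_{k-1}}^\Delta(\alpha_{i_k})$ (so $\beta_1^\Delta=\alpha_{i_1}$). $M(w^\Delta)$ is the $m\times m$ skew-symmetric matrix whose $(i,\ell)$-entry, for $i<\ell$, is $\langle\beta_{t_i}|\beta_{t_\ell}\rangle$, regarded as a linear map $\mathbb{Q}^m\to\mathbb{Q}^m$; $w+w^\Delta$ is regarded as a linear map $V\to V$. $\boldsymbol e_1,\dots,\boldsymbol e_m$ is the standard basis of $\mathbb{Q}^m$. *)

theory Defs
  imports
    "HOL-Analysis.Euclidean_Space"
    "HOL-Algebra.Bij"
    "HOL-Algebra.Generated_Groups"
    "Jordan_Normal_Form.VS_Connect"
begin

no_notation scalar_prod (infix \<open>\<bullet>\<close> 70)
notation inner (infix \<open>\<bullet>\<close> 70)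

text \<open>
  A simple complex Lie algebra enters only through its root system, i.e. an irreducible reduced
  crystallographic root system; its Euclidean space is the type, with the inner product of the
  type class.  All reflections are orthogonal, so this inner product is Weyl group invariant.
\<close>

definition coroot :: "'a::euclidean_space \<Rightarrow> 'a" where
  "coroot a = (2 / (a \<bullet> a)) *\<^sub>R a"

definition reflection :: "'a::euclidean_space \<Rightarrow> 'a \<Rightarrow> 'a" where
  "reflection a x = x - (x \<bullet> coroot a) *\<^sub>R a"

definition root_system :: "'a::euclidean_space set \<Rightarrow> bool" where
  "root_system \<Phi> \<longleftrightarrow>
     finite \<Phi> \<and> 0 \<notin> \<Phi> \<and> Real_Vector_Spaces.span \<Phi> = UNIV \<and>
     (\<forall>a\<in>\<Phi>. reflection a ` \<Phi> = \<Phi>) \<and>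
     (\<forall>a\<in>\<Phi>. \<forall>b\<in>\<Phi>. b \<bullet> coroot a \<in> \<int>) \<and>
     (\<forall>a\<in>\<Phi>. \<forall>c. c *\<^sub>R a \<in> \<Phi> \<longrightarrow> c = 1 \<or> c = -1)"

definition irreducible_root_system :: "'a::euclidean_space set \<Rightarrow> bool" where
  "irreducible_root_system \<Phi> \<longleftrightarrow>
     root_system \<Phi> \<and> \<Phi> \<noteq> {} \<and>
     \<not> (\<exists>A B. A \<noteq> {} \<and> B \<noteq> {} \<and> A \<inter> B = {} \<and> A \<union> B = \<Phi> \<and> (\<forall>a\<in>A. \<forall>b\<in>B. a \<bullet> b = 0))"

text \<open>
  The short roots are those of minimal length; when only one root length occurs, all roots
  are short.
\<close>

definition short_roots_normalised :: "'a::euclidean_space set \<Rightarrow> bool" where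
  "short_roots_normalised \<Phi> \<longleftrightarrow> Min (norm ` \<Phi>) = sqrt 2"

definition simple_roots :: "'a::euclidean_space set \<Rightarrow> nat \<Rightarrow> (nat \<Rightarrow> 'a) \<Rightarrow> bool" where
  "simple_roots \<Phi> n \<alpha> \<longleftrightarrow>
     \<alpha> ` {1..n} \<subseteq> \<Phi> \<and> inj_on \<alpha> {1..n} \<and>
     Real_Vector_Spaces.independent (\<alpha> ` {1..n}) \<and>
     Real_Vector_Spaces.span (\<alpha> ` {1..n}) = UNIV \<and>
     (\<forall>b\<in>\<Phi>. \<exists>c :: nat \<Rightarrow> nat. b = (\<Sum>j\<in>{1..n}. real (c j) *\<^sub>R \<alpha> j) \<or>
                                  b = - (\<Sum>j\<in>{1..n}. real (c j) *\<^sub>R \<alpha> j))"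

definition fundamental_weights :: "nat \<Rightarrow> (nat \<Rightarrow> 'a::euclidean_space) \<Rightarrow> (nat \<Rightarrow> 'a) \<Rightarrow> bool" where
  "fundamental_weights n \<alpha> \<omega> \<longleftrightarrow>
     (\<forall>j\<in>{1..n}. \<forall>i\<in>{1..n}. \<omega> j \<bullet> coroot (\<alpha> i) = (if i = j then 1 else 0))"

definition weyl_group :: "nat \<Rightarrow> (nat \<Rightarrow> 'a::euclidean_space) \<Rightarrow> ('a \<Rightarrow> 'a) set" where
  "weyl_group n \<alpha> = generate (BijGroup UNIV) ((\<lambda>j. reflection (\<alpha> j)) ` {1..n})"

text \<open>\<open>ordered_comp f k\<close> is \<open>f 1 \<circ> f 2 \<circ> \<dots> \<circ> f k\<close>; words are indexed from 1.\<close>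

primrec ordered_comp :: "(nat \<Rightarrow> 'a \<Rightarrow> 'a) \<Rightarrow> nat \<Rightarrow> 'a \<Rightarrow> 'a" where
  "ordered_comp f 0 = id"
| "ordered_comp f (Suc k) = ordered_comp f k \<circ> f (Suc k)"

definition word_prod :: "(nat \<Rightarrow> 'a::euclidean_space) \<Rightarrow> (nat \<Rightarrow> nat) \<Rightarrow> nat \<Rightarrow> 'a \<Rightarrow> 'a" where
  "word_prod \<alpha> i k = ordered_comp (\<lambda>j. reflection (\<alpha> (i j))) k"

definition subword_prod ::
  "(nat \<Rightarrow> 'a::euclidean_space) \<Rightarrow> (nat \<Rightarrow> nat) \<Rightarrow> nat set \<Rightarrow> nat \<Rightarrow> 'a \<Rightarrow> 'a" where
  "subword_prod \<alpha> i \<Delta> k = ordered_comp (\<lambda>j. if j \<in> \<Delta> then reflection (\<alpha> (i j)) else id) k"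

definition is_word ::
  "nat \<Rightarrow> (nat \<Rightarrow> 'a::euclidean_space) \<Rightarrow> (nat \<Rightarrow> nat) \<Rightarrow> nat \<Rightarrow> ('a \<Rightarrow> 'a) \<Rightarrow> bool" where
  "is_word n \<alpha> i t w \<longleftrightarrow> (\<forall>k\<in>{1..t}. i k \<in> {1..n}) \<and> w = word_prod \<alpha> i t"

definition weyl_length :: "nat \<Rightarrow> (nat \<Rightarrow> 'a::euclidean_space) \<Rightarrow> ('a \<Rightarrow> 'a) \<Rightarrow> nat" where
  "weyl_length n \<alpha> w = (LEAST t. \<exists>i. is_word n \<alpha> i t w)"

definition reduced_decomposition ::
  "nat \<Rightarrow> (nat \<Rightarrow> 'a::euclidean_space) \<Rightarrow> (nat \<Rightarrow> nat) \<Rightarrow> nat \<Rightarrow> ('a \<Rightarrow> 'a) \<Rightarrow> bool" where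
  "reduced_decomposition n \<alpha> i t w \<longleftrightarrow> is_word n \<alpha> i t w \<and> t = weyl_length n \<alpha> w"

definition beta :: "(nat \<Rightarrow> 'a::euclidean_space) \<Rightarrow> (nat \<Rightarrow> nat) \<Rightarrow> nat \<Rightarrow> 'a" where
  "beta \<alpha> i k = word_prod \<alpha> i (k - 1) (\<alpha> (i k))"

definition sub_beta ::
  "(nat \<Rightarrow> 'a::euclidean_space) \<Rightarrow> (nat \<Rightarrow> nat) \<Rightarrow> nat set \<Rightarrow> nat \<Rightarrow> 'a" where
  "sub_beta \<alpha> i \<Delta> k = subword_prod \<alpha> i \<Delta> (k - 1) (\<alpha> (i k))"

text \<open>
  The positions deleted from the word, in increasing order.  Vectors and matrices are indexed
  from 0, so \<open>deleted_position t \<Delta> h\<close> is \<open>t\<^sub>h\<^sub>+\<^sub>1\<close>.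
\<close>

definition num_deleted :: "nat \<Rightarrow> nat set \<Rightarrow> nat" where
  "num_deleted t \<Delta> = card ({1..t} - \<Delta>)"

definition deleted_position :: "nat \<Rightarrow> nat set \<Rightarrow> nat \<Rightarrow> nat" where
  "deleted_position t \<Delta> h = sorted_list_of_set ({1..t} - \<Delta>) ! h"

definition M_matrix ::
  "(nat \<Rightarrow> 'a::euclidean_space) \<Rightarrow> (nat \<Rightarrow> nat) \<Rightarrow> nat \<Rightarrow> nat set \<Rightarrow> real mat" where
  "M_matrix \<alpha> i t \<Delta> =
     (let b = (\<lambda>h. beta \<alpha> i (deleted_position t \<Delta> h)) in
      mat (num_deleted t \<Delta>) (num_deleted t \<Delta>)
        (\<lambda>(r, c). if r < c then b r \<bullet> b c else if c < r then - (b c \<bullet> b r) else 0))"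

text \<open>
  The rational vector spaces below are carried by rational points of real ones.
  The fields \<open>mult\<close> and \<open>one\<close> of a module record are irrelevant for the module structure.
\<close>

definition rat_weight_space :: "nat \<Rightarrow> (nat \<Rightarrow> 'a::euclidean_space) \<Rightarrow> (rat, 'a) module" where
  "rat_weight_space n \<omega> =
     \<lparr>carrier = {x. \<exists>q :: nat \<Rightarrow> rat. x = (\<Sum>j\<in>{1..n}. of_rat (q j) *\<^sub>R \<omega> j)},
      mult = undefined, one = undefined, zero = 0, add = (+),
      smult = (\<lambda>q x. of_rat q *\<^sub>R x)\<rparr>"

definition rat_coord_space :: "nat \<Rightarrow> (rat, real vec) module" where
  "rat_coord_space m =
     \<lparr>carrier = {v \<in> carrier_vec m. \<forall>h<m. v $ h \<in> \<rat>},
      mult = undefined, one = undefined, zero = 0\<^sub>v m, add = (+),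
      smult = (\<lambda>q v. of_rat q \<cdot>\<^sub>v v)\<rparr>"

definition ker_sum ::
  "nat \<Rightarrow> (nat \<Rightarrow> 'a::euclidean_space) \<Rightarrow> ('a \<Rightarrow> 'a) \<Rightarrow> ('a \<Rightarrow> 'a) \<Rightarrow> (rat, 'a) module" where
  "ker_sum n \<omega> u v = (rat_weight_space n \<omega>)
     \<lparr>carrier := {x \<in> carrier (rat_weight_space n \<omega>). u x + v x = 0}\<rparr>"

definition ker_matrix :: "nat \<Rightarrow> real mat \<Rightarrow> (rat, real vec) module" where
  "ker_matrix m A = (rat_coord_space m)
     \<lparr>carrier := {v \<in> carrier (rat_coord_space m). A *\<^sub>v v = 0\<^sub>v m}\<rparr>"

definition Psi ::
  "(nat \<Rightarrow> 'a::euclidean_space) \<Rightarrow> (nat \<Rightarrow> nat) \<Rightarrow> nat \<Rightarrow> nat set \<Rightarrow> 'a \<Rightarrow> real vec" where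
  "Psi \<alpha> i t \<Delta> x =
     vec (num_deleted t \<Delta>)
       (\<lambda>h. coroot (sub_beta \<alpha> i \<Delta> (deleted_position t \<Delta> h)) \<bullet> subword_prod \<alpha> i \<Delta> t x)"

definition rat_linear_iso ::
  "(rat, 'a) module \<Rightarrow> (rat, 'b) module \<Rightarrow> ('a \<Rightarrow> 'b) \<Rightarrow> bool" where
  "rat_linear_iso V W T \<longleftrightarrow>
     linear_map (class_ring :: rat ring) V W T \<and> bij_betw T (carrier V) (carrier W)"

end

theory Submission
  imports Defs
begin

text \<open>
  Write \<open>u\<^sub>k\<close> and \<open>v\<^sub>k\<close> for the products of the first \<open>k\<close> letters of the word and of its
  subword, so that \<open>w = u\<^sub>t\<close> and \<open>w\<^sup>\<Delta> = v\<^sub>t\<close>.  Fix a vector \<open>y\<close> and follow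
  \<open>x\<^sub>k = u\<^sub>k (v\<^sub>k\<^sup>-\<^sup>1 y)\<close> from \<open>x\<^sub>0 = y\<close> to \<open>x\<^sub>t = w ((w\<^sup>\<Delta>)\<^sup>-\<^sup>1 y)\<close>.  A letter kept in the
  subword cancels and leaves \<open>x\<^sub>k\<close> unchanged.  A deleted letter acts on one side only and subtracts
  \<open>c\<^sub>k \<beta>\<^sub>k\<close>, where \<open>c\<^sub>k\<close> is the inner product of \<open>y\<close> with the coroot of \<open>\<beta>\<^sub>k\<^sup>\<Delta>\<close>, or
  equally that of \<open>x\<^sub>k\<^sub>-\<^sub>1\<close> with the coroot of \<open>\<beta>\<^sub>k\<close>.  Summing up
  (\<open>word_prod_strip_subword\<close>), the vector \<open>\<gamma>\<close> lies in the kernel of \<open>w + w\<^sup>\<Delta>\<close> if and only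
  if \<open>y = w\<^sup>\<Delta> \<gamma>\<close> satisfies \<open>2 y = \<Sum> c\<^sub>l \<beta>\<^sub>l\<close>, the sum taken over the deleted positions.  The
  numbers \<open>c\<^sub>l\<close> are the coordinates of \<open>\<Psi>(\<gamma>)\<close>, so \<open>\<Psi>\<close> is injective on the kernel.

  If \<open>2 y = \<Sum> c\<^sub>l \<beta>\<^sub>l\<close> for any coefficients \<open>c\<^sub>l\<close>, then \<open>y - \<Sum>\<^sub>l\<^sub><\<^sub>k c\<^sub>l \<beta>\<^sub>l\<close> is half of
  \<open>c\<^sub>k \<beta>\<^sub>k + \<Sum>\<^sub>l\<^sub>>\<^sub>k c\<^sub>l \<beta>\<^sub>l - \<Sum>\<^sub>l\<^sub><\<^sub>k c\<^sub>l \<beta>\<^sub>l\<close>, and pairing it with the coroot of \<open>\<beta>\<^sub>k\<close> gives \<open>c\<^sub>k\<close>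
  plus a multiple of the \<open>k\<close>-th entry of \<open>M c\<close> (\<open>coroot_partial_sum\<close>).  When the \<open>c\<^sub>l\<close>
  come from \<open>\<gamma>\<close>, the pairing is \<open>c\<^sub>k\<close>, whence \<open>M c = 0\<close>.  Conversely, start from \<open>M c = 0\<close>,
  put \<open>y = (\<Sum> c\<^sub>l \<beta>\<^sub>l) / 2\<close> and \<open>\<gamma> = (w\<^sup>\<Delta>)\<^sup>-\<^sup>1 y\<close>; induction on \<open>k\<close> shows that the \<open>c\<^sub>k\<close> are
  the coordinates of \<open>\<Psi>(\<gamma>)\<close>, and then \<open>2 y = \<Sum> c\<^sub>l \<beta>\<^sub>l\<close> says that \<open>\<gamma>\<close> lies in the kernel.

  Both passages stay within rational points, because \<open>V\<close> consists of the vectors whose inner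
  products with all simple coroots are rational: it contains the simple roots by integrality and
  is therefore stable under the simple reflections.
\<close>

section \<open>Reflections and products of reflections\<close>

lemma linear_reflection: "linear (reflection a)"
  by (rule linearI) (simp_all add: reflection_def inner_add_left algebra_simps)

lemma reflection_reflection [simp]: "reflection a (reflection a x) = x"
  by (cases "a = 0") (simp_all add: reflection_def coroot_def inner_diff_left)

lemma inner_reflection_swap: "reflection a x \<bullet> y = x \<bullet> reflection a y"
  by (simp add: reflection_def coroot_def inner_diff_left inner_diff_right inner_commute)

lemma inner_reflection_reflection [simp]: "reflection a x \<bullet> reflection a y = x \<bullet> y"
  by (metis inner_reflection_swap reflection_reflection)

text \<open>Keeping every letter recovers the word, so facts about subwords cover words as well.\<close>

lemma word_prod_eq_subword_prod: "word_prod \<alpha> i k = subword_prod \<alpha> i UNIV k"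
  by (simp add: word_prod_def subword_prod_def)

lemma subword_prod_0 [simp]: "subword_prod \<alpha> i \<Delta> 0 x = x"
  by (simp add: subword_prod_def)

lemma subword_prod_Suc [simp]:
  "subword_prod \<alpha> i \<Delta> (Suc k) x =
     subword_prod \<alpha> i \<Delta> k (if Suc k \<in> \<Delta> then reflection (\<alpha> (i (Suc k))) x else x)"
  by (simp add: subword_prod_def)

lemma word_prod_0 [simp]: "word_prod \<alpha> i 0 x = x"
  by (simp add: word_prod_eq_subword_prod)

lemma word_prod_Suc [simp]:
  "word_prod \<alpha> i (Suc k) x = word_prod \<alpha> i k (reflection (\<alpha> (i (Suc k))) x)"
  by (simp add: word_prod_eq_subword_prod)

lemma linear_subword_prod: "linear (subword_prod \<alpha> i \<Delta> k)"
proof (induction k)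
  case 0
  show ?case by (rule linearI) simp_all
next
  case (Suc k)
  show ?case
    by (rule linearI)
       (simp_all add: linear_add[OF Suc.IH] linear_cmul[OF Suc.IH]
          linear_add[OF linear_reflection] linear_cmul[OF linear_reflection])
qed

lemma linear_word_prod: "linear (word_prod \<alpha> i k)"
  by (simp add: word_prod_eq_subword_prod linear_subword_prod)

lemma inner_subword_prod [simp]:
  "subword_prod \<alpha> i \<Delta> k x \<bullet> subword_prod \<alpha> i \<Delta> k y = x \<bullet> y"
  by (induction k arbitrary: x y) simp_all

lemma inner_word_prod [simp]: "word_prod \<alpha> i k x \<bullet> word_prod \<alpha> i k y = x \<bullet> y"
  by (simp add: word_prod_eq_subword_prod)

lemma inj_subword_prod: "subword_prod \<alpha> i \<Delta> k x = subword_prod \<alpha> i \<Delta> k y \<Longrightarrow> x = y"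
proof -
  assume eq: "subword_prod \<alpha> i \<Delta> k x = subword_prod \<alpha> i \<Delta> k y"
  then have "subword_prod \<alpha> i \<Delta> k (x - y) = 0"
    by (simp add: linear_diff[OF linear_subword_prod])
  then have "(x - y) \<bullet> (x - y) = 0"
    by (metis inner_subword_prod inner_zero_left)
  then show "x = y" by simp
qed

lemma coroot_inner: "coroot a \<bullet> x = (a \<bullet> (2 *\<^sub>R x)) / (a \<bullet> a)"
  by (simp add: coroot_def)

lemma coroot_isometric_image:
  assumes "linear f" and "\<And>x y. f x \<bullet> f y = x \<bullet> y"
  shows "coroot (f a) = f (coroot a)"
  by (simp add: coroot_def assms linear_cmul)

lemma coroot_sub_beta: "coroot (sub_beta \<alpha> i \<Delta> k) = subword_prod \<alpha> i \<Delta> (k - 1) (coroot (\<alpha> (i k)))"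
  by (simp add: sub_beta_def coroot_isometric_image linear_subword_prod)

lemma coroot_beta: "coroot (beta \<alpha> i k) = word_prod \<alpha> i (k - 1) (coroot (\<alpha> (i k)))"
  by (simp add: beta_def coroot_isometric_image linear_word_prod)

section \<open>Comparing a word with its subword\<close>

text \<open>
  The vector \<open>v\<^sub>k\<^sup>-\<^sup>1 y\<close> for the length-\<open>k\<close> prefix product \<open>v\<^sub>k\<close> of the subword.  Peeling off one
  reflection at a time makes it available to induction on \<open>k\<close> without inverse functions.
\<close>

primrec strip_subword ::
  "(nat \<Rightarrow> 'a::euclidean_space) \<Rightarrow> (nat \<Rightarrow> nat) \<Rightarrow> nat set \<Rightarrow> 'a \<Rightarrow> nat \<Rightarrow> 'a" where
  "strip_subword \<alpha> i \<Delta> y 0 = y"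
| "strip_subword \<alpha> i \<Delta> y (Suc k) =
     (if Suc k \<in> \<Delta> then reflection (\<alpha> (i (Suc k))) (strip_subword \<alpha> i \<Delta> y k)
      else strip_subword \<alpha> i \<Delta> y k)"

lemma subword_prod_strip_subword [simp]:
  "subword_prod \<alpha> i \<Delta> k (strip_subword \<alpha> i \<Delta> y k) = y"
  by (induction k) simp_all

text \<open>Move \<open>v\<^sub>k\<^sub>-\<^sub>1\<close> to the other side of the inner product; it is an isometry.\<close>

lemma coroot_sub_beta_inner:
  "coroot (sub_beta \<alpha> i \<Delta> k) \<bullet> y = coroot (\<alpha> (i k)) \<bullet> strip_subword \<alpha> i \<Delta> y (k - 1)"
  by (metis coroot_sub_beta inner_subword_prod subword_prod_strip_subword)

text \<open>
  The comparison of the two words.  In the induction step a kept letter occurs on both sides and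
  cancels as an involution; a deleted letter \<open>s\<close> occurs only in the word, and \<open>s z - z\<close> is a
  multiple of its root, which \<open>u\<^sub>k\<^sub>-\<^sub>1\<close> carries to \<open>\<beta>\<^sub>k\<close>.
\<close>

lemma word_prod_strip_subword:
  "word_prod \<alpha> i k (strip_subword \<alpha> i \<Delta> y k) =
     y - (\<Sum>l\<in>{1..k} - \<Delta>. (coroot (sub_beta \<alpha> i \<Delta> l) \<bullet> y) *\<^sub>R beta \<alpha> i l)"
proof (induction k)
  case 0
  show ?case by simp
next
  case (Suc k)
  show ?case
  proof (cases "Suc k \<in> \<Delta>")
    case True
    then have "{1..Suc k} - \<Delta> = {1..k} - \<Delta>"
      by (auto simp: le_Suc_eq)
    with True Suc.IH show ?thesis by simp
  next
    case False
    let ?a = "\<alpha> (i (Suc k))" and ?z = "strip_subword \<alpha> i \<Delta> y k"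
    have "word_prod \<alpha> i (Suc k) (strip_subword \<alpha> i \<Delta> y (Suc k)) =
        word_prod \<alpha> i k (?z - (coroot ?a \<bullet> ?z) *\<^sub>R ?a)"
      using False by (simp add: reflection_def inner_commute)
    also have "\<dots> = word_prod \<alpha> i k ?z -
        (coroot (sub_beta \<alpha> i \<Delta> (Suc k)) \<bullet> y) *\<^sub>R beta \<alpha> i (Suc k)"
      by (simp add: linear_diff[OF linear_word_prod] linear_cmul[OF linear_word_prod]
          beta_def coroot_sub_beta_inner)
    moreover have "{1..Suc k} - \<Delta> = insert (Suc k) ({1..k} - \<Delta>)"
      using False by (auto simp: le_Suc_eq)
    ultimately show ?thesis
      using Suc.IH by (simp add: algebra_simps)
  qed
qed

lemma word_plus_subword_eq_0_iff:
  assumes "y = subword_prod \<alpha> i \<Delta> t x"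
  shows "word_prod \<alpha> i t x + y = 0 \<longleftrightarrow>
     2 *\<^sub>R y = (\<Sum>l\<in>{1..t} - \<Delta>. (coroot (sub_beta \<alpha> i \<Delta> l) \<bullet> y) *\<^sub>R beta \<alpha> i l)"
proof -
  have "strip_subword \<alpha> i \<Delta> y t = x"
    using assms by (metis inj_subword_prod subword_prod_strip_subword)
  then have eq: "word_prod \<alpha> i t x =
      y - (\<Sum>l\<in>{1..t} - \<Delta>. (coroot (sub_beta \<alpha> i \<Delta> l) \<bullet> y) *\<^sub>R beta \<alpha> i l)"
    using word_prod_strip_subword[of \<alpha> i t \<Delta> y] by simp
  show ?thesis
    unfolding eq scaleR_2 diff_add_eq by (rule right_minus_eq)
qed

text \<open>
  Each coordinate is determined by \<open>y\<close> and the coordinates at earlier deleted positions, since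
  \<open>y\<close> minus the partial sum is \<open>u\<^sub>k\<^sub>-\<^sub>1 (v\<^sub>k\<^sub>-\<^sub>1\<^sup>-\<^sup>1 y)\<close> and \<open>u\<^sub>k\<^sub>-\<^sub>1\<close> is an isometry taking the simple root
  at position \<open>k\<close> to \<open>\<beta>\<^sub>k\<close>.
\<close>

lemma coroot_sub_beta_recursion:
  assumes "k \<in> {1..t} - \<Delta>"
  shows "coroot (sub_beta \<alpha> i \<Delta> k) \<bullet> y = coroot (beta \<alpha> i k) \<bullet>
     (y - (\<Sum>l | l \<in> {1..t} - \<Delta> \<and> l < k. (coroot (sub_beta \<alpha> i \<Delta> l) \<bullet> y) *\<^sub>R beta \<alpha> i l))"
proof -
  have "{l \<in> {1..t} - \<Delta>. l < k} = {1..k - 1} - \<Delta>"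
    using assms by auto
  then show ?thesis
    by (simp only: coroot_sub_beta_inner[of \<alpha> i \<Delta> k] coroot_beta inner_word_prod
        word_prod_strip_subword[of \<alpha> i "k - 1" \<Delta> y, symmetric])
qed

section \<open>The skew-symmetric system\<close>

text \<open>
  The entries of the matrix \<open>M\<close>, indexed by positions in the word instead of by their rank among
  the deleted ones.
\<close>

definition skew_gram :: "(nat \<Rightarrow> 'a::euclidean_space) \<Rightarrow> nat \<Rightarrow> nat \<Rightarrow> real" where
  "skew_gram b k l = (if k < l then b k \<bullet> b l else if l < k then - (b l \<bullet> b k) else 0)"

text \<open>
  Subtracting the terms before \<open>k\<close> from half the full sum leaves half of the \<open>k\<close>-th term plus half
  the difference of the later and the earlier terms, and this sign change at \<open>k\<close> is the one in the
  skew-symmetric matrix.  The diagonal term contributes exactly \<open>c k\<close>, because a nonzero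
  vector pairs with its own coroot to 2.
\<close>

lemma coroot_partial_sum:
  fixes b :: "nat \<Rightarrow> 'a::euclidean_space"
  assumes "finite D" and "k \<in> D" and "b k \<noteq> 0"
    and "2 *\<^sub>R y = (\<Sum>l\<in>D. c l *\<^sub>R b l)"
  shows "coroot (b k) \<bullet> (y - (\<Sum>l | l \<in> D \<and> l < k. c l *\<^sub>R b l)) =
     c k + (\<Sum>l\<in>D. skew_gram b k l * c l) / (b k \<bullet> b k)"
proof -
  have split: "(\<Sum>l\<in>D. f l) = (\<Sum>l | l \<in> D \<and> l < k. f l) + f k + (\<Sum>l | l \<in> D \<and> k < l. f l)"
    for f :: "nat \<Rightarrow> 'b::comm_monoid_add"
  proof -
    have "D = {l \<in> D. l < k} \<union> (insert k {l \<in> D. k < l})"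
      using \<open>k \<in> D\<close> by auto
    then have "(\<Sum>l\<in>D. f l) = sum f ({l \<in> D. l < k} \<union> insert k {l \<in> D. k < l})"
      by simp
    also have "\<dots> = (\<Sum>l | l \<in> D \<and> l < k. f l) + sum f (insert k {l \<in> D. k < l})"
      using \<open>finite D\<close> by (intro sum.union_disjoint) auto
    finally show ?thesis
      using \<open>finite D\<close> by (simp add: add.assoc)
  qed
  let ?L = "\<Sum>l | l \<in> D \<and> l < k. c l *\<^sub>R b l" and ?R = "\<Sum>l | l \<in> D \<and> k < l. c l *\<^sub>R b l"
  have "(\<Sum>l | l \<in> D \<and> l < k. skew_gram b k l * c l) = - (b k \<bullet> ?L)"
    unfolding inner_sum_right sum_negf[symmetric]
    by (intro sum.cong refl) (simp add: skew_gram_def inner_commute)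
  moreover have "(\<Sum>l | l \<in> D \<and> k < l. skew_gram b k l * c l) = b k \<bullet> ?R"
    unfolding inner_sum_right
    by (intro sum.cong refl) (simp add: skew_gram_def)
  ultimately have skew: "(\<Sum>l\<in>D. skew_gram b k l * c l) = b k \<bullet> (?R - ?L)"
    by (subst split) (simp add: skew_gram_def inner_diff_right)
  have "2 *\<^sub>R (y - ?L) = ?R - ?L + c k *\<^sub>R b k"
    using assms(4) split[of "\<lambda>l. c l *\<^sub>R b l"] by (simp add: algebra_simps scaleR_2)
  then have "coroot (b k) \<bullet> (y - ?L) = (b k \<bullet> (?R - ?L + c k *\<^sub>R b k)) / (b k \<bullet> b k)"
    using coroot_inner[of "b k" "y - ?L"] by simp
  also have "\<dots> = c k + (b k \<bullet> (?R - ?L)) / (b k \<bullet> b k)"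
    using \<open>b k \<noteq> 0\<close> by (simp add: inner_add_right add_divide_distrib)
  finally show ?thesis by (simp only: skew)
qed

text \<open>
  Two evaluations of the same pairing, by \<open>coroot_sub_beta_recursion\<close> and by
  \<open>coroot_partial_sum\<close>, differ by the \<open>k\<close>-th entry of \<open>M c\<close> up to a nonzero factor.
\<close>

lemma skew_system_of_coroots:
  assumes "\<And>k. k \<in> {1..t} \<Longrightarrow> beta \<alpha> i k \<noteq> 0"
    and "2 *\<^sub>R y = (\<Sum>l\<in>{1..t} - \<Delta>. (coroot (sub_beta \<alpha> i \<Delta> l) \<bullet> y) *\<^sub>R beta \<alpha> i l)"
    and "k \<in> {1..t} - \<Delta>"
  shows "(\<Sum>l\<in>{1..t} - \<Delta>. skew_gram (beta \<alpha> i) k l * (coroot (sub_beta \<alpha> i \<Delta> l) \<bullet> y)) = 0"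
proof -
  have nz: "beta \<alpha> i k \<noteq> 0" using assms by auto
  show ?thesis
    using coroot_partial_sum[OF _ assms(3) nz assms(2)]
      coroot_sub_beta_recursion[OF assms(3), of \<alpha> i y] nz by simp
qed

text \<open>
  The vector \<open>y\<close> built from a solution of the system gives back the solution: once the earlier
  coordinates agree, the recursion for the next one evaluates by \<open>coroot_partial_sum\<close> to \<open>c k\<close>.
\<close>

lemma coroots_of_skew_system:
  assumes nz: "\<And>k. k \<in> {1..t} \<Longrightarrow> beta \<alpha> i k \<noteq> 0"
    and y: "2 *\<^sub>R y = (\<Sum>l\<in>{1..t} - \<Delta>. c l *\<^sub>R beta \<alpha> i l)"
    and skew: "\<And>k. k \<in> {1..t} - \<Delta> \<Longrightarrow>
      (\<Sum>l\<in>{1..t} - \<Delta>. skew_gram (beta \<alpha> i) k l * c l) = 0"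
    and "k \<in> {1..t} - \<Delta>"
  shows "coroot (sub_beta \<alpha> i \<Delta> k) \<bullet> y = c k"
  using \<open>k \<in> {1..t} - \<Delta>\<close>
proof (induction k rule: less_induct)
  case (less k)
  have nzk: "beta \<alpha> i k \<noteq> 0" using nz less.prems by auto
  have "coroot (sub_beta \<alpha> i \<Delta> k) \<bullet> y = coroot (beta \<alpha> i k) \<bullet>
      (y - (\<Sum>l | l \<in> {1..t} - \<Delta> \<and> l < k. c l *\<^sub>R beta \<alpha> i l))"
    using less.IH
    by (subst coroot_sub_beta_recursion[OF less.prems])
       (intro arg_cong2[where f = inner] arg_cong2[where f = minus] sum.cong refl, auto)
  also have "\<dots> = c k"
    using coroot_partial_sum[OF _ less.prems nzk y] skew[OF less.prems] by simp
  finally show ?case .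
qed

section \<open>Indexing by deleted positions\<close>

lemma bij_betw_deleted_position:
  "bij_betw (deleted_position t \<Delta>) {..<num_deleted t \<Delta>} ({1..t} - \<Delta>)"
  unfolding deleted_position_def num_deleted_def
  by (rule bij_betw_nth) auto

lemma deleted_position_less:
  assumes "r < s" and "s < num_deleted t \<Delta>"
  shows "deleted_position t \<Delta> r < deleted_position t \<Delta> s"
  using sorted_wrt_nth_less[OF strict_sorted_list_of_set, of r s] assms
  by (simp add: deleted_position_def num_deleted_def)

lemma M_matrix_entry:
  assumes "r < num_deleted t \<Delta>" and "s < num_deleted t \<Delta>"
  shows "M_matrix \<alpha> i t \<Delta> $$ (r, s) =
     skew_gram (beta \<alpha> i) (deleted_position t \<Delta> r) (deleted_position t \<Delta> s)"
  using assms deleted_position_less[of r s t \<Delta>] deleted_position_less[of s r t \<Delta>]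
  by (cases r s rule: linorder_cases) (auto simp: M_matrix_def skew_gram_def)

text \<open>
  Ranks among the deleted positions are traded for the positions: the enumeration is increasing,
  so it preserves the order comparison that decides the sign of an entry.
\<close>

lemma M_matrix_kernel_iff:
  assumes "\<And>h. h < num_deleted t \<Delta> \<Longrightarrow> v $ h = c (deleted_position t \<Delta> h)"
    and "dim_vec v = num_deleted t \<Delta>"
  shows "M_matrix \<alpha> i t \<Delta> *\<^sub>v v = 0\<^sub>v (num_deleted t \<Delta>) \<longleftrightarrow>
     (\<forall>k\<in>{1..t} - \<Delta>. (\<Sum>l\<in>{1..t} - \<Delta>. skew_gram (beta \<alpha> i) k l * c l) = 0)"
proof -
  let ?m = "num_deleted t \<Delta>" and ?p = "deleted_position t \<Delta>"
  have entry: "(M_matrix \<alpha> i t \<Delta> *\<^sub>v v) $ r =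
      (\<Sum>l\<in>{1..t} - \<Delta>. skew_gram (beta \<alpha> i) (?p r) l * c l)" if "r < ?m" for r
  proof -
    have "(M_matrix \<alpha> i t \<Delta> *\<^sub>v v) $ r = (\<Sum>s<?m. M_matrix \<alpha> i t \<Delta> $$ (r, s) * v $ s)"
      using that assms(2)
      by (simp add: M_matrix_def scalar_prod_def lessThan_atLeast0)
    also have "\<dots> = (\<Sum>s<?m. skew_gram (beta \<alpha> i) (?p r) (?p s) * c (?p s))"
      using that assms(1) by (simp add: M_matrix_entry)
    also have "\<dots> = (\<Sum>l\<in>{1..t} - \<Delta>. skew_gram (beta \<alpha> i) (?p r) l * c l)"
      by (rule sum.reindex_bij_betw[OF bij_betw_deleted_position])
    finally show ?thesis .
  qed
  have "M_matrix \<alpha> i t \<Delta> *\<^sub>v v = 0\<^sub>v ?m \<longleftrightarrow> (\<forall>r<?m. (M_matrix \<alpha> i t \<Delta> *\<^sub>v v) $ r = 0)"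
    by (auto simp: vec_eq_iff M_matrix_def)
  also have "\<dots> \<longleftrightarrow> (\<forall>r\<in>{..<?m}. (\<Sum>l\<in>{1..t} - \<Delta>. skew_gram (beta \<alpha> i) (?p r) l * c l) = 0)"
    by (simp only: entry lessThan_iff Ball_def cong: imp_cong)
  also have "\<dots> \<longleftrightarrow> (\<forall>k\<in>?p ` {..<?m}. (\<Sum>l\<in>{1..t} - \<Delta>. skew_gram (beta \<alpha> i) k l * c l) = 0)"
    by blast
  finally show ?thesis
    by (simp only: bij_betw_imp_surj_on[OF bij_betw_deleted_position])
qed

section \<open>Rational points\<close>

text \<open>
  Membership in \<open>V\<close>, expressed without coordinates (see \<open>rat_weight_space_iff\<close>).  In this form
  closure under a simple reflection only needs the rationality of its root.
\<close>

definition rational_weight :: "nat \<Rightarrow> (nat \<Rightarrow> 'a::euclidean_space) \<Rightarrow> 'a \<Rightarrow> bool" where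
  "rational_weight n \<alpha> x \<longleftrightarrow> (\<forall>j\<in>{1..n}. x \<bullet> coroot (\<alpha> j) \<in> \<rat>)"

lemma rational_weight_diff:
  "rational_weight n \<alpha> x \<Longrightarrow> rational_weight n \<alpha> y \<Longrightarrow> rational_weight n \<alpha> (x - y)"
  by (simp add: rational_weight_def inner_diff_left Rats_diff)

lemma rational_weight_add:
  "rational_weight n \<alpha> x \<Longrightarrow> rational_weight n \<alpha> y \<Longrightarrow> rational_weight n \<alpha> (x + y)"
  by (simp add: rational_weight_def inner_add_left Rats_add)

lemma rational_weight_scaleR:
  "c \<in> \<rat> \<Longrightarrow> rational_weight n \<alpha> x \<Longrightarrow> rational_weight n \<alpha> (c *\<^sub>R x)"
  by (simp add: rational_weight_def Rats_mult)

lemma rational_weight_sum: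
  assumes "\<And>k. k \<in> A \<Longrightarrow> rational_weight n \<alpha> (f k)"
  shows "rational_weight n \<alpha> (sum f A)"
  using assms
  by (induction A rule: infinite_finite_induct)
     (simp_all add: rational_weight_add rational_weight_def[of n \<alpha> 0])

lemma rational_weight_reflection:
  assumes "rational_weight n \<alpha> (\<alpha> j)" and "j \<in> {1..n}" and "rational_weight n \<alpha> x"
  shows "rational_weight n \<alpha> (reflection (\<alpha> j) x)"
proof -
  have "x \<bullet> coroot (\<alpha> j) \<in> \<rat>"
    using assms(2,3) by (simp add: rational_weight_def)
  with assms show ?thesis
    unfolding reflection_def by (intro rational_weight_diff rational_weight_scaleR)
qed

lemma rational_weight_subword_prod:
  assumes "\<And>j. j \<in> {1..n} \<Longrightarrow> rational_weight n \<alpha> (\<alpha> j)"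
    and "\<And>l. l \<in> {1..k} \<Longrightarrow> i l \<in> {1..n}" and "rational_weight n \<alpha> x"
  shows "rational_weight n \<alpha> (subword_prod \<alpha> i \<Delta> k x)"
  using assms(2,3)
proof (induction k arbitrary: x)
  case (Suc k)
  then have "i (Suc k) \<in> {1..n}" by simp
  with Suc assms(1) show ?case
    by (simp add: rational_weight_reflection)
qed simp

lemma rational_weight_strip_subword:
  assumes "\<And>j. j \<in> {1..n} \<Longrightarrow> rational_weight n \<alpha> (\<alpha> j)"
    and "\<And>l. l \<in> {1..k} \<Longrightarrow> i l \<in> {1..n}" and "rational_weight n \<alpha> y"
  shows "rational_weight n \<alpha> (strip_subword \<alpha> i \<Delta> y k)"
  using assms(2)
proof (induction k)
  case (Suc k)
  then have "i (Suc k) \<in> {1..n}" by simp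
  with Suc assms(1) show ?case
    by (simp add: rational_weight_reflection)
qed (simp add: assms(3))

text \<open>
  The inner products with the simple coroots are the coordinates with respect to the fundamental
  weights: a vector and the combination of weights with these coordinates differ by a vector
  orthogonal to the simple roots, which span the space.
\<close>

lemma rat_weight_space_iff:
  assumes "\<And>j. j \<in> {1..n} \<Longrightarrow> \<alpha> j \<noteq> 0"
    and "Real_Vector_Spaces.span (\<alpha> ` {1..n}) = UNIV"
    and "fundamental_weights n \<alpha> \<omega>"
  shows "x \<in> carrier (rat_weight_space n \<omega>) \<longleftrightarrow> rational_weight n \<alpha> x"
proof -
  have coord: "(\<Sum>j\<in>{1..n}. of_rat (q j) *\<^sub>R \<omega> j) \<bullet> coroot (\<alpha> k) = of_rat (q k)"
    if "k \<in> {1..n}" for q :: "nat \<Rightarrow> rat" and k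
  proof -
    have "(\<Sum>j\<in>{1..n}. of_rat (q j) *\<^sub>R \<omega> j) \<bullet> coroot (\<alpha> k) =
        (\<Sum>j\<in>{1..n}. if k = j then of_rat (q j) else 0)"
      using assms(3) that unfolding inner_sum_left
      by (intro sum.cong) (auto simp: fundamental_weights_def)
    then show ?thesis using that by simp
  qed
  show ?thesis
    unfolding rational_weight_def
  proof
    assume "x \<in> carrier (rat_weight_space n \<omega>)"
    then obtain q :: "nat \<Rightarrow> rat" where "x = (\<Sum>j\<in>{1..n}. of_rat (q j) *\<^sub>R \<omega> j)"
      by (auto simp: rat_weight_space_def)
    then show "\<forall>j\<in>{1..n}. x \<bullet> coroot (\<alpha> j) \<in> \<rat>"
      using coord by auto
  next
    assume rat: "\<forall>j\<in>{1..n}. x \<bullet> coroot (\<alpha> j) \<in> \<rat>"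
    then have "\<forall>j\<in>{1..n}. \<exists>r :: rat. x \<bullet> coroot (\<alpha> j) = of_rat r"
      by (auto elim!: Rats_cases)
    then obtain q :: "nat \<Rightarrow> rat" where q: "\<forall>j\<in>{1..n}. x \<bullet> coroot (\<alpha> j) = of_rat (q j)"
      by metis
    define d where "d = x - (\<Sum>j\<in>{1..n}. of_rat (q j) *\<^sub>R \<omega> j)"
    have orth: "d \<bullet> \<alpha> j = 0" if "j \<in> {1..n}" for j
    proof -
      have "d \<bullet> coroot (\<alpha> j) = 0"
        using that q coord[OF that, of q] by (simp add: d_def inner_diff_left)
      then show ?thesis using assms(1)[OF that] by (simp add: coroot_def)
    qed
    have "d \<bullet> y = 0" if "y \<in> Real_Vector_Spaces.span (\<alpha> ` {1..n})" for y
      using that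
      by (induction rule: real_vector.span_induct_alt) (use orth in \<open>auto simp: inner_add_right\<close>)
    then have "d \<bullet> d = 0"
      using assms(2) by blast
    then have "x = (\<Sum>j\<in>{1..n}. of_rat (q j) *\<^sub>R \<omega> j)"
      by (simp add: d_def)
    then show "x \<in> carrier (rat_weight_space n \<omega>)"
      by (auto simp: rat_weight_space_def)
  qed
qed

section \<open>Kernels as rational vector spaces\<close>

lemma vectorspace_rat_weight_subspace:
  assumes "0 \<in> S" and "\<And>x y. x \<in> S \<Longrightarrow> y \<in> S \<Longrightarrow> x + y \<in> S"
    and "\<And>q x. x \<in> S \<Longrightarrow> of_rat q *\<^sub>R x \<in> S"
  shows "vectorspace class_ring ((rat_weight_space n \<omega>)\<lparr>carrier := S\<rparr>)"
proof -
  have neg: "- x \<in> S" if "x \<in> S" for x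
    using assms(3)[OF that, of "-1"] by (simp add: of_rat_minus)
  have "abelian_group ((rat_weight_space n \<omega>)\<lparr>carrier := S\<rparr>)"
    by (rule abelian_groupI)
       (auto simp: rat_weight_space_def assms algebra_simps intro!: bexI[OF _ neg])
  moreover have "cring (class_ring :: rat ring)"
    using class_field by (rule fieldE)
  ultimately have "Module.module class_ring ((rat_weight_space n \<omega>)\<lparr>carrier := S\<rparr>)"
    by (intro Module.moduleI)
       (auto simp: rat_weight_space_def assms algebra_simps of_rat_add of_rat_mult)
  then show ?thesis
    by (simp add: vectorspace_def class_field)
qed

lemma vectorspace_ker_sum:
  assumes "linear u" and "linear v"
    and V: "\<And>x. x \<in> carrier (rat_weight_space n \<omega>) \<longleftrightarrow> rational_weight n \<alpha> x"
  shows "vectorspace class_ring (ker_sum n \<omega> u v)"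
  unfolding ker_sum_def
proof (rule vectorspace_rat_weight_subspace)
  show "0 \<in> {x \<in> carrier (rat_weight_space n \<omega>). u x + v x = 0}"
    by (simp add: V rational_weight_def linear_0 assms)
next
  fix x y
  assume "x \<in> {x \<in> carrier (rat_weight_space n \<omega>). u x + v x = 0}"
    and "y \<in> {x \<in> carrier (rat_weight_space n \<omega>). u x + v x = 0}"
  then show "x + y \<in> {x \<in> carrier (rat_weight_space n \<omega>). u x + v x = 0}"
    using add_eq_0_iff2[of "u x"]
    by (auto simp: V rational_weight_add linear_add assms eq_neg_iff_add_eq_0[symmetric])
next
  fix q x
  assume "x \<in> {x \<in> carrier (rat_weight_space n \<omega>). u x + v x = 0}"
  then show "of_rat q *\<^sub>R x \<in> {x \<in> carrier (rat_weight_space n \<omega>). u x + v x = 0}"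
    by (simp add: V rational_weight_scaleR linear_cmul assms scaleR_add_right[symmetric])
qed

lemma vectorspace_ker_matrix:
  assumes A: "A \<in> carrier_mat m m"
  shows "vectorspace class_ring (ker_matrix m A)"
proof -
  have inverse: "\<exists>y\<in>carrier (ker_matrix m A). y \<oplus>\<^bsub>ker_matrix m A\<^esub> x = \<zero>\<^bsub>ker_matrix m A\<^esub>"
    if "x \<in> carrier (ker_matrix m A)" for x
  proof -
    have x: "x \<in> carrier_vec m" "A *\<^sub>v x = 0\<^sub>v m"
      using that by (auto simp: ker_matrix_def rat_coord_space_def)
    have "- x = (-1) \<cdot>\<^sub>v x"
      by (rule eq_vecI) simp_all
    then have "A *\<^sub>v - x = 0\<^sub>v m"
      using x mult_mat_vec[OF A x(1), of "-1"] by auto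
    then show ?thesis
      using that by (intro bexI[of _ "- x"]) (auto simp: ker_matrix_def rat_coord_space_def)
  qed
  have "abelian_group (ker_matrix m A)"
    by (rule abelian_groupI[OF _ _ _ _ _ inverse])
       (use A in \<open>auto simp: ker_matrix_def rat_coord_space_def mult_add_distrib_mat_vec
         intro!: comm_add_vec assoc_add_vec\<close>)
  moreover have "cring (class_ring :: rat ring)"
    using class_field by (rule fieldE)
  ultimately have "Module.module class_ring (ker_matrix m A)"
    by (intro Module.moduleI)
       (use A in \<open>auto simp: ker_matrix_def rat_coord_space_def mult_mat_vec of_rat_add
         of_rat_mult smult_add_distrib_vec add_smult_distrib_vec smult_smult_assoc\<close>)
  then show ?thesis
    by (simp add: vectorspace_def class_field)
qed

section \<open>The isomorphism\<close>

theorem theorem3p6: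
  fixes \<Phi> :: "'a::euclidean_space set"
    and n t :: nat
    and \<alpha> \<omega> :: "nat \<Rightarrow> 'a"
    and i :: "nat \<Rightarrow> nat"
    and w :: "'a \<Rightarrow> 'a"
    and \<Delta> :: "nat set"
  assumes "irreducible_root_system \<Phi>"
    and "short_roots_normalised \<Phi>"
    and "simple_roots \<Phi> n \<alpha>"
    and "fundamental_weights n \<alpha> \<omega>"
    and "w \<in> weyl_group n \<alpha>"
    and "reduced_decomposition n \<alpha> i t w"
    and "\<Delta> \<subseteq> {1..t}"
  shows "rat_linear_iso
           (ker_sum n \<omega> w (subword_prod \<alpha> i \<Delta> t))
           (ker_matrix (num_deleted t \<Delta>) (M_matrix \<alpha> i t \<Delta>))
           (Psi \<alpha> i t \<Delta>)"
proof -
  let ?m = "num_deleted t \<Delta>" and ?p = "deleted_position t \<Delta>" and ?D = "{1..t} - \<Delta>"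
  let ?v = "subword_prod \<alpha> i \<Delta> t"
  let ?K = "ker_sum n \<omega> w ?v" and ?L = "ker_matrix ?m (M_matrix \<alpha> i t \<Delta>)"
  let ?c = "\<lambda>y l. coroot (sub_beta \<alpha> i \<Delta> l) \<bullet> y"
  have root: "\<alpha> j \<in> \<Phi>" if "j \<in> {1..n}" for j
    using assms(3) that by (auto simp: simple_roots_def)
  have rs: "root_system \<Phi>"
    using assms(1) by (simp add: irreducible_root_system_def)
  have nz: "\<alpha> j \<noteq> 0" if "j \<in> {1..n}" for j
    using root[OF that] rs by (auto simp: root_system_def)
  have rat: "rational_weight n \<alpha> (\<alpha> j)" if "j \<in> {1..n}" for j
    using root that rs Ints_subset_Rats by (auto simp: rational_weight_def root_system_def)
  have V: "x \<in> carrier (rat_weight_space n \<omega>) \<longleftrightarrow> rational_weight n \<alpha> x" for x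
    using nz assms(3,4) by (intro rat_weight_space_iff) (auto simp: simple_roots_def)
  have "is_word n \<alpha> i t w"
    using assms(6) unfolding reduced_decomposition_def by blast
  then have w: "w = word_prod \<alpha> i t" and word: "\<forall>l\<in>{1..t}. i l \<in> {1..n}"
    unfolding is_word_def by blast+
  have i: "i l \<in> {1..n}" if "l \<in> {1..t}" for l
    using word that by blast
  have beta_nz: "beta \<alpha> i k \<noteq> 0" if "k \<in> {1..t}" for k
    using nz[OF i[OF that]] unfolding beta_def by (metis inner_eq_zero_iff inner_word_prod)
  have beta_rat: "rational_weight n \<alpha> (beta \<alpha> i k)" if "k \<in> {1..t}" for k
    unfolding beta_def word_prod_eq_subword_prod
    using i that by (intro rational_weight_subword_prod rat) auto
  have c_rat: "?c y k \<in> \<rat>" if "rational_weight n \<alpha> y" and "k \<in> {1..t}" for y k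
  proof -
    have "rational_weight n \<alpha> (strip_subword \<alpha> i \<Delta> y (k - 1))"
      using i that by (intro rational_weight_strip_subword rat) auto
    then show ?thesis
      using i[OF that(2)] unfolding coroot_sub_beta_inner[of \<alpha> i \<Delta> k] rational_weight_def
      by (metis inner_commute)
  qed
  have p: "?p h \<in> ?D" if "h < ?m" for h
    using bij_betwE[OF bij_betw_deleted_position] that by blast
  have onto: "\<exists>h<?m. l = ?p h" if "l \<in> ?D" for l
  proof -
    have "l \<in> ?p ` {..<?m}"
      using that by (simp only: bij_betw_imp_surj_on[OF bij_betw_deleted_position])
    then show ?thesis by blast
  qed
  have K: "x \<in> carrier ?K \<longleftrightarrow> rational_weight n \<alpha> x \<and>
      2 *\<^sub>R ?v x = (\<Sum>l\<in>?D. ?c (?v x) l *\<^sub>R beta \<alpha> i l)" for x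
    by (simp add: ker_sum_def V w word_plus_subword_eq_0_iff[OF refl])
  have Psi: "Psi \<alpha> i t \<Delta> x $ h = ?c (?v x) (?p h)" if "h < ?m" for x h
    using that by (simp add: Psi_def)
  have Psi_dim: "Psi \<alpha> i t \<Delta> x \<in> carrier_vec ?m" for x
    by (simp add: Psi_def)

  have Psi_in: "Psi \<alpha> i t \<Delta> x \<in> carrier ?L" if "x \<in> carrier ?K" for x
  proof -
    have x: "rational_weight n \<alpha> x"
      and y: "2 *\<^sub>R ?v x = (\<Sum>l\<in>?D. ?c (?v x) l *\<^sub>R beta \<alpha> i l)"
      using that K by auto
    have "M_matrix \<alpha> i t \<Delta> *\<^sub>v Psi \<alpha> i t \<Delta> x = 0\<^sub>v ?m"
      using skew_system_of_coroots[OF beta_nz y] Psi Psi_dim[of x]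
      by (subst M_matrix_kernel_iff[where c = "?c (?v x)"]) auto
    moreover have "rational_weight n \<alpha> (?v x)"
      using rat i x by (intro rational_weight_subword_prod)
    ultimately show ?thesis
      using c_rat p Psi_dim by (auto simp: ker_matrix_def rat_coord_space_def Psi)
  qed

  (* In the kernel the coordinates determine 2 w^Delta x, hence x. *)
  have inj: "inj_on (Psi \<alpha> i t \<Delta>) (carrier ?K)"
  proof (rule inj_onI)
    fix x x'
    assume x: "x \<in> carrier ?K" and x': "x' \<in> carrier ?K"
      and eq: "Psi \<alpha> i t \<Delta> x = Psi \<alpha> i t \<Delta> x'"
    have "?c (?v x) l = ?c (?v x') l" if "l \<in> ?D" for l
      using onto[OF that] Psi[of _ x] Psi[of _ x'] eq by metis
    then have "2 *\<^sub>R ?v x = 2 *\<^sub>R ?v x'"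
      using x x' by (simp add: K)
    then show "x = x'"
      using inj_subword_prod[of \<alpha> i \<Delta> t x x'] by simp
  qed

  (* A preimage comes from half the combination of the beta_l with the given coordinates. *)
  have surj: "\<exists>x\<in>carrier ?K. Psi \<alpha> i t \<Delta> x = v" if v: "v \<in> carrier ?L" for v
  proof -
    define c where "c l = v $ inv_into {..<?m} ?p l" for l
    have vc: "v $ h = c (?p h)" if "h < ?m" for h
      using that bij_betw_inv_into_left[OF bij_betw_deleted_position, of h t \<Delta>]
      by (simp add: c_def)
    have c_rats: "c l \<in> \<rat>" if "l \<in> ?D" for l
    proof -
      have "v $ h \<in> \<rat>" if "h < ?m" for h
        using v that by (simp add: ker_matrix_def rat_coord_space_def)
      then show ?thesis using onto[OF that] vc by metis
    qed
    have skew: "(\<Sum>l\<in>?D. skew_gram (beta \<alpha> i) k l * c l) = 0" if "k \<in> ?D" for k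
      using v that M_matrix_kernel_iff[of t \<Delta> v c \<alpha> i] vc
      by (auto simp: ker_matrix_def rat_coord_space_def)
    define y where "y = (1/2) *\<^sub>R (\<Sum>l\<in>?D. c l *\<^sub>R beta \<alpha> i l)"
    define x where "x = strip_subword \<alpha> i \<Delta> y t"
    have vx: "?v x = y" by (simp add: x_def)
    have y: "2 *\<^sub>R y = (\<Sum>l\<in>?D. c l *\<^sub>R beta \<alpha> i l)" by (simp add: y_def)
    have cy: "?c y l = c l" if "l \<in> ?D" for l
      using coroots_of_skew_system[OF beta_nz y skew that] .
    have "rational_weight n \<alpha> y"
      unfolding y_def
      by (intro rational_weight_scaleR rational_weight_sum beta_rat c_rats) auto
    then have "rational_weight n \<alpha> x"
      unfolding x_def using i by (intro rational_weight_strip_subword rat)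
    then have "x \<in> carrier ?K"
      using y cy by (simp add: K vx)
    moreover have "Psi \<alpha> i t \<Delta> x = v"
      using v Psi_dim[of x] cy p vc
      by (intro eq_vecI) (auto simp: ker_matrix_def rat_coord_space_def Psi vx)
    ultimately show ?thesis by blast
  qed

  have "bij_betw (Psi \<alpha> i t \<Delta>) (carrier ?K) (carrier ?L)"
    using Psi_in inj surj unfolding bij_betw_def by blast
  moreover have "linear_map (class_ring :: rat ring) ?K ?L (Psi \<alpha> i t \<Delta>)"
  proof -
    have VK: "vectorspace (class_ring :: rat ring) ?K"
      unfolding w by (rule vectorspace_ker_sum[OF linear_word_prod linear_subword_prod V])
    have VL: "vectorspace (class_ring :: rat ring) ?L"
      by (rule vectorspace_ker_matrix) (simp add: M_matrix_def)
    have add: "Psi \<alpha> i t \<Delta> (x + y) = Psi \<alpha> i t \<Delta> x + Psi \<alpha> i t \<Delta> y" for x y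
      by (rule eq_vecI) (simp_all add: Psi_def linear_add[OF linear_subword_prod] inner_add_right)
    have smult: "Psi \<alpha> i t \<Delta> (r *\<^sub>R x) = r \<cdot>\<^sub>v Psi \<alpha> i t \<Delta> x" for r x
      by (rule eq_vecI) (simp_all add: Psi_def linear_cmul[OF linear_subword_prod])
    have "Psi \<alpha> i t \<Delta> \<in> LinearCombinations.module_hom (class_ring :: rat ring) ?K ?L"
      using Psi_in add smult
      by (auto simp: module_hom_def ker_sum_def ker_matrix_def rat_weight_space_def
          rat_coord_space_def)
    with VK VL show ?thesis
      by (simp add: linear_map_def mod_hom_def mod_hom_axioms_def vectorspace_def)
  qed
  ultimately show ?thesis
    by (simp add: rat_linear_iso_def)
qed

end
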